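(* Let $G=(V,E)$ be a finite undirected graph with $V=\{1,\dots,n\}$, $n$ even, and let each edge $e\in E$ carry a weight vector $(w_{e1},\dots,w_{ek})$ of positive real numbers. For $S\subseteq V$ let $x^S\in\{0,1\}^V$ be its indicator vector ($x^S_i=1$ iff $i\in S$). Consider the mixed integer linear program $$\max U$$ subject to $$U\le \sum_{e\in E} w_{el}\, y_e \quad (1\le l\le k),$$ $$x_{i}+x_{j}\ge y_e \quad (e=\{i,j\}\in E),$$ $$x_{i}+x_{j}+y_e\le 2 \quad (e=\{i,j\}\in E),$$ $$\sum_{i=1}^n x_i = n/2,$$ $$x_i\in\{0,1\}\ (i\in V),\quad y_e\in\{0,1\}\ (e\in E),\quad U\in[0,+\infty).$$ Then a partition of $V$ into $S$ and $V\setminus S$ is an optimal solution of the multidimensional maximum bisection problem on $G$ if and only if there exist $y\in\{0,1\}^E$ and $U\ge 0$ such that $(x^S,y,U)$ is a feasible solution of this program attaining its maximum value.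
   Context: For $S\subseteq V$, the cut determined by $S$ is $C(S)=\{e\in E : e\cap S\neq\emptyset \text{ and } e\cap (V\setminus S)\neq\emptyset\}$, and its weight is $w(C(S))=\min_{1\le l\le k}\sum_{\{i,j\}\in C(S)} w_{ijl}$. The multidimensional maximum bisection problem asks for a set $S\subseteq V$ with $|S|=|V\setminus S|$ maximizing $w(C(S))$; an optimal solution is such an $S$ (equivalently the partition $\{S,V\setminus S\}$) attaining this maximum. *)

theory Defs
  imports Complex_Main "HOL-Library.Indicator_Function"
begin

text \<open>
  An edge is the set of its endpoints, so \<open>{i, j}\<close> with \<open>i = j\<close> is a loop. Loops are permitted;
  they never belong to a cut.
\<close>

definition undirected_graph :: "'v set \<Rightarrow> 'v set set \<Rightarrow> bool" where
  "undirected_graph V E \<longleftrightarrow> finite V \<and> (\<forall>e\<in>E. \<exists>i\<in>V. \<exists>j\<in>V. e = {i, j})"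

definition cut :: "'v set \<Rightarrow> 'v set set \<Rightarrow> 'v set \<Rightarrow> 'v set set" where
  "cut V E S = {e \<in> E. e \<inter> S \<noteq> {} \<and> e \<inter> (V - S) \<noteq> {}}"

text \<open>\<^const>\<open>Min\<close> of the empty set is unspecified: this is meaningful only for \<open>k \<ge> 1\<close>.\<close>

definition cut_weight ::
  "'v set \<Rightarrow> 'v set set \<Rightarrow> nat \<Rightarrow> ('v set \<Rightarrow> nat \<Rightarrow> real) \<Rightarrow> 'v set \<Rightarrow> real" where
  "cut_weight V E k w S = (MIN l\<in>{1..k}. \<Sum>e\<in>cut V E S. w e l)"

definition bisection :: "'v set \<Rightarrow> 'v set \<Rightarrow> bool" where
  "bisection V S \<longleftrightarrow> S \<subseteq> V \<and> card S = card (V - S)"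

definition optimal_bisection ::
  "'v set \<Rightarrow> 'v set set \<Rightarrow> nat \<Rightarrow> ('v set \<Rightarrow> nat \<Rightarrow> real) \<Rightarrow> 'v set \<Rightarrow> bool" where
  "optimal_bisection V E k w S \<longleftrightarrow>
     bisection V S \<and> (\<forall>T. bisection V T \<longrightarrow> cut_weight V E k w T \<le> cut_weight V E k w S)"

text \<open>
  Vectors indexed by \<open>V\<close> and \<open>E\<close> are total functions; their values outside \<open>V\<close> and \<open>E\<close> are
  unconstrained and occur neither in the constraints nor in the objective \<open>U\<close>.
\<close>

definition milp_feasible ::
  "'v set \<Rightarrow> 'v set set \<Rightarrow> nat \<Rightarrow> ('v set \<Rightarrow> nat \<Rightarrow> real) \<Rightarrow>
   ('v \<Rightarrow> real) \<Rightarrow> ('v set \<Rightarrow> real) \<Rightarrow> real \<Rightarrow> bool" where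
  "milp_feasible V E k w x y U \<longleftrightarrow>
     (\<forall>l\<in>{1..k}. U \<le> (\<Sum>e\<in>E. w e l * y e)) \<and>
     (\<forall>i j. {i, j} \<in> E \<longrightarrow> x i + x j \<ge> y {i, j}) \<and>
     (\<forall>i j. {i, j} \<in> E \<longrightarrow> x i + x j + y {i, j} \<le> 2) \<and>
     (\<Sum>i\<in>V. x i) = real (card V) / 2 \<and>
     (\<forall>i\<in>V. x i \<in> {0, 1}) \<and>
     (\<forall>e\<in>E. y e \<in> {0, 1}) \<and>
     U \<ge> 0"

definition milp_optimal ::
  "'v set \<Rightarrow> 'v set set \<Rightarrow> nat \<Rightarrow> ('v set \<Rightarrow> nat \<Rightarrow> real) \<Rightarrow>
   ('v \<Rightarrow> real) \<Rightarrow> ('v set \<Rightarrow> real) \<Rightarrow> real \<Rightarrow> bool" where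
  "milp_optimal V E k w x y U \<longleftrightarrow>
     milp_feasible V E k w x y U \<and>
     (\<forall>x' y' U'. milp_feasible V E k w x' y' U' \<longrightarrow> U' \<le> U)"

end

theory Submission
  imports Defs
begin

text \<open>
  The edge constraints force \<open>y\<^sub>e = 0\<close> outside the cut of the support \<open>T\<close> of \<open>x\<close> and leave \<open>y\<^sub>e\<close>
  free on the cut. As the weights are positive, the largest \<open>U\<close> feasible for \<open>T\<close> is therefore the
  weight of its cut, reached by taking \<open>y\<close> to be the indicator of the cut.
\<close>

lemma undirected_graph_finite_edges:
  assumes "undirected_graph V E"
  shows "finite E"
proof (rule finite_subset)
  show "E \<subseteq> Pow V" using assms by (auto simp: undirected_graph_def)
  show "finite (Pow V)" using assms by (simp add: undirected_graph_def)
qed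

text \<open>Links the combinatorial balance condition to the program's constraint that the entries
  of \<open>x\<close> sum to \<open>n/2\<close>.\<close>

lemma bisection_iff_card:
  assumes "finite V" "T \<subseteq> V"
  shows "bisection V T \<longleftrightarrow> real (card T) = real (card V) / 2"
proof -
  have "card V = card T + card (V - T)"
    using assms by (metis card_Diff_subset card_mono finite_subset le_add_diff_inverse)
  then show ?thesis using assms by (auto simp: bisection_def)
qed

text \<open>With \<open>k \<ge> 1\<close> the index set is nonempty, so \<open>Min\<close> is a
  genuine greatest lower bound. This matches the program's \<open>k\<close> separate bounds on
  \<open>U\<close>.\<close>

lemma le_cut_weight_iff:
  assumes "k \<ge> 1"
  shows "U \<le> cut_weight V E k w T \<longleftrightarrow> (\<forall>l\<in>{1..k}. U \<le> (\<Sum>e\<in>cut V E T. w e l))"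
  using assms by (auto simp: cut_weight_def)

lemma milp_feasible_imp_cut:
  assumes "undirected_graph V E" "k \<ge> 1"
    and nonneg: "\<And>e l. e \<in> E \<Longrightarrow> l \<in> {1..k} \<Longrightarrow> w e l \<ge> 0"
    and feas: "milp_feasible V E k w x y U"
  defines "T \<equiv> {i \<in> V. x i = 1}"
  shows "bisection V T" "U \<le> cut_weight V E k w T"
proof -
  have V: "finite V" using assms(1) by (simp add: undirected_graph_def)
  have E: "finite E" using assms(1) by (rule undirected_graph_finite_edges)
  have x01: "x i = 0 \<or> x i = 1" if "i \<in> V" for i
    using feas that by (auto simp: milp_feasible_def)
  have y01: "y e = 0 \<or> y e = 1" if "e \<in> E" for e
    using feas that by (auto simp: milp_feasible_def)
  \<comment> \<open>Since \<open>x\<close> is 0/1 on \<open>V\<close>, its sum counts its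
    support.\<close>
  have "real (card T) = (\<Sum>i\<in>V. if x i = 1 then 1 else 0)"
    using V by (simp add: T_def sum.If_cases Collect_conj_eq)
  also have "\<dots> = (\<Sum>i\<in>V. x i)"
    using x01 by (intro sum.cong) auto
  also have "\<dots> = real (card V) / 2" using feas by (simp add: milp_feasible_def)
  finally show "bisection V T" using V by (subst bisection_iff_card) (auto simp: T_def)
  have y0: "y e = 0" if e: "e \<in> E" "e \<notin> cut V E T" for e
  proof -
    obtain i j where ij: "i \<in> V" "j \<in> V" "e = {i, j}"
      using assms(1) e(1) unfolding undirected_graph_def by meson
    have "x i + x j \<ge> y e" "x i + x j + y e \<le> 2"
      using feas e(1) ij(3) by (simp_all add: milp_feasible_def)
    \<comment> \<open>An edge outside the cut has both ends on the same side of \<open>T\<close>. If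
      the common value is 0, the first constraint gives \<open>y e \<le> 0\<close>; if it is 1, the
      second does. Loops are covered by \<open>i = j\<close>.\<close>
    moreover have "x i = x j"
      using x01[OF ij(1)] x01[OF ij(2)] ij e by (auto simp: cut_def T_def)
    ultimately show ?thesis using x01[OF ij(1)] y01[OF e(1)] by auto
  qed
  have "U \<le> (\<Sum>e\<in>cut V E T. w e l)" if l: "l \<in> {1..k}" for l
  proof -
    have "U \<le> (\<Sum>e\<in>E. w e l * y e)" using feas l by (simp add: milp_feasible_def)
    also have "\<dots> = (\<Sum>e\<in>cut V E T. w e l * y e)"
      using E y0 by (intro sum.mono_neutral_right) (auto simp: cut_def)
    also have "\<dots> \<le> (\<Sum>e\<in>cut V E T. w e l)"
    proof (rule sum_mono)
      fix e assume "e \<in> cut V E T"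
      then have "e \<in> E" by (simp add: cut_def)
      then show "w e l * y e \<le> w e l" using y01[of e] nonneg[of e l] l by auto
    qed
    finally show ?thesis .
  qed
  then show "U \<le> cut_weight V E k w T" using assms(2) by (simp add: le_cut_weight_iff)
qed

lemma bisection_imp_milp_feasible:
  assumes "undirected_graph V E" "k \<ge> 1"
    and nonneg: "\<And>e l. e \<in> E \<Longrightarrow> l \<in> {1..k} \<Longrightarrow> w e l \<ge> 0"
    and "bisection V T"
  shows "milp_feasible V E k w (indicator T) (indicator (cut V E T)) (cut_weight V E k w T)"
proof -
  have V: "finite V" using assms(1) by (simp add: undirected_graph_def)
  have E: "finite E" using assms(1) by (rule undirected_graph_finite_edges)
  have T: "T \<subseteq> V" using assms(4) by (simp add: bisection_def)
  have sum: "(\<Sum>e\<in>E. w e l * indicator (cut V E T) e) = (\<Sum>e\<in>cut V E T. w e l)" for l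
    using E by (intro sum.mono_neutral_cong_right) (auto simp: cut_def)
  have card: "(\<Sum>i\<in>V. indicator T i) = real (card V) / 2"
    using V T assms(4)
    by (simp add: bisection_iff_card indicator_def sum.If_cases Int_absorb1)
  \<comment> \<open>The program also demands \<open>U \<ge> 0\<close>; nonnegative weights supply
    it.\<close>
  have "cut_weight V E k w T \<ge> 0"
    using nonneg assms(2) by (auto simp: le_cut_weight_iff cut_def intro!: sum_nonneg)
  moreover have "\<forall>l\<in>{1..k}. cut_weight V E k w T \<le> (\<Sum>e\<in>cut V E T. w e l)"
    using le_cut_weight_iff[OF assms(2), THEN iffD1, OF order_refl] .
  \<comment> \<open>A pair in the cut has exactly one end in \<open>T\<close>, so the two indicators
    sum to 1; for any other pair the bounds are trivial.\<close>
  moreover have "indicator (cut V E T) {i, j} \<le> (indicator T i + indicator T j :: real)"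
    and "indicator T i + indicator T j + indicator (cut V E T) {i, j} \<le> (2 :: real)" for i j
    by (auto simp: cut_def indicator_def)
  ultimately show ?thesis
    unfolding milp_feasible_def sum card by (simp add: indicator_def)
qed

theorem theorem1:
  fixes n k :: nat
    and V :: "nat set"
    and E :: "nat set set"
    and w :: "nat set \<Rightarrow> nat \<Rightarrow> real"
    and S :: "nat set"
  assumes "V = {1..n}"
    and "even n"
    and "k \<ge> 1"
    and "undirected_graph V E"
    and "\<And>e l. e \<in> E \<Longrightarrow> l \<in> {1..k} \<Longrightarrow> w e l > 0"
    and "S \<subseteq> V"
  shows "optimal_bisection V E k w S \<longleftrightarrow>
    (\<exists>(y :: nat set \<Rightarrow> real) (U :: real).
       (\<forall>e\<in>E. y e \<in> {0, 1}) \<and> U \<ge> 0 \<and> milp_optimal V E k w (indicator S) y U)"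
proof -
  have nonneg: "w e l \<ge> 0" if "e \<in> E" "l \<in> {1..k}" for e l
    using assms(5)[OF that] by simp
  have upper: "bisection V {i \<in> V. x i = 1}" "U \<le> cut_weight V E k w {i \<in> V. x i = 1}"
    if "milp_feasible V E k w x y U" for x y U
    using milp_feasible_imp_cut[OF assms(4,3) _ that] nonneg by blast+
  have attained:
    "milp_feasible V E k w (indicator T) (indicator (cut V E T)) (cut_weight V E k w T)"
    if "bisection V T" for T
    using bisection_imp_milp_feasible[OF assms(4,3) _ that] nonneg by blast
  show ?thesis
  proof
    assume opt: "optimal_bisection V E k w S"
    have feas: "milp_feasible V E k w (indicator S) (indicator (cut V E S)) (cut_weight V E k w S)"
      using attained opt by (simp add: optimal_bisection_def)
    \<comment> \<open>The support of \<open>x'\<close> is a bisection whose cut weight bounds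
      \<open>U'\<close>, and \<open>S\<close> is at least as good as that bisection.\<close>
    moreover have "U' \<le> cut_weight V E k w S" if "milp_feasible V E k w x' y' U'" for x' y' U'
      using upper[OF that] opt by (meson optimal_bisection_def order_trans)
    ultimately have "milp_optimal V E k w (indicator S) (indicator (cut V E S)) (cut_weight V E k w S)"
      by (simp add: milp_optimal_def)
    moreover have "\<forall>e\<in>E. indicator (cut V E S) e \<in> {0, 1 :: real}" "cut_weight V E k w S \<ge> 0"
      using feas by (simp_all add: milp_feasible_def)
    ultimately show "\<exists>(y :: nat set \<Rightarrow> real) U.
        (\<forall>e\<in>E. y e \<in> {0, 1}) \<and> U \<ge> 0 \<and> milp_optimal V E k w (indicator S) y U"
      by (intro exI[of _ "indicator (cut V E S)"] exI[of _ "cut_weight V E k w S"] conjI)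
  next
    assume "\<exists>(y :: nat set \<Rightarrow> real) U.
        (\<forall>e\<in>E. y e \<in> {0, 1}) \<and> U \<ge> 0 \<and> milp_optimal V E k w (indicator S) y U"
    then obtain y U where opt: "milp_optimal V E k w (indicator S) y U" by blast
    \<comment> \<open>The support of the given solution is \<open>S\<close> itself, so the upper
      bound speaks about \<open>S\<close>.\<close>
    have "{i \<in> V. indicator S i = (1 :: real)} = S"
      using assms(6) by (auto simp: indicator_def)
    then have S: "bisection V S" "U \<le> cut_weight V E k w S"
      using upper[of "indicator S" y U] opt by (simp_all add: milp_optimal_def)
    \<comment> \<open>The feasible point built from \<open>T\<close> competes with the optimum
      \<open>U\<close>, and \<open>U\<close> is at most the cut weight of \<open>S\<close>.\<close>
    have "cut_weight V E k w T \<le> U" if "bisection V T" for T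
      using attained[OF that] opt by (auto simp: milp_optimal_def)
    with S show "optimal_bisection V E k w S"
      by (auto simp: optimal_bisection_def intro: order_trans)
  qed
qed

end
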